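(* Let $P,Q$ be two Markov kernels on a measurable space $(M,\mathcal F)$ such that for every $x\in M$, $$\left\|\delta_xP^tQ-\delta_xQP^t\right\|_{TV}\to 0\quad\text{as } t\to\infty .$$ Suppose further that there is $c>0$ such that for all $x\in M$ and $A\in\mathcal F$, $$Q_x(A)\le c\cdot\tilde P_x(A),\qquad\text{where }\tilde P=\sum_{n\ge 0}\frac{1}{2^{n+1}}P^n .$$ Then $H^\infty(M,P)\subseteq H^\infty(M,Q)$; that is, every bounded $P$-harmonic function is also $Q$-harmonic.
   Context: A Markov kernel on $(M,\mathcal F)$ is a map $P\colon M\times\mathcal F\to[0,1]$ such that $P_x=P(x,\cdot)$ is a probability measure for each $x\in M$ and $P(\cdot,A)$ is $\mathcal F$-measurable for each $A\in\mathcal F$. For a measure $\kappa$ on $M$, $(\kappa P)(A)=\int_M P(x,A)\,d\kappa(x)$; products and powers of kernels are compositions, so $\delta_xP^tQ$ is the law after $t$ steps of $P$ followed by one step of $Q$ started at $x$, and $P^0$ is the identity kernel. $\|\cdot\|_{TV}$ is the total-variation norm. $H^\infty(M,P)$ is the set of bounded $\mathcal F$-measurable $h\colon M\to\mathbb{R}$ with $h(x)=\int_M h(y)\,dP_x(y)$ for all $x\in M$. *)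

theory Defs
  imports "HOL-Probability.Probability"
begin

text \<open>
  The measurable space \<open>(M, \<F>)\<close> is \<open>(space M, sets M)\<close> for \<open>M :: 'a measure\<close>;
  the measure carried by \<open>M\<close> plays no role.
\<close>

definition markov_kernel :: "'a measure \<Rightarrow> ('a \<Rightarrow> 'a measure) \<Rightarrow> bool" where
  "markov_kernel M P \<longleftrightarrow>
     (\<forall>x\<in>space M. prob_space (P x) \<and> sets (P x) = sets M) \<and>
     (\<forall>A\<in>sets M. (\<lambda>x. measure (P x) A) \<in> borel_measurable M)"

lemma markov_kernel_iff_measurable:
  "markov_kernel M P \<longleftrightarrow> P \<in> M \<rightarrow>\<^sub>M prob_algebra M"
proof
  assume P: "markov_kernel M P"
  have "P \<in> M \<rightarrow>\<^sub>M subprob_algebra M"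
  proof (rule measurable_subprob_algebra)
    fix A assume A: "A \<in> sets M"
    have "(\<lambda>x. ennreal (measure (P x) A)) \<in> borel_measurable M"
      using P A by (auto simp: markov_kernel_def)
    moreover have "emeasure (P x) A = ennreal (measure (P x) A)" if "x \<in> space M" for x
      using P that
      by (auto simp: markov_kernel_def prob_space_def finite_measure.emeasure_eq_measure)
    ultimately show "(\<lambda>x. emeasure (P x) A) \<in> borel_measurable M"
      by (simp cong: measurable_cong)
  qed (use P in \<open>auto simp: markov_kernel_def intro: prob_space_imp_subprob_space\<close>)
  with P show "P \<in> M \<rightarrow>\<^sub>M prob_algebra M"
    by (auto simp: markov_kernel_def prob_algebra_def intro!: measurable_restrict_space2
        dest: measurable_space)
next
  assume P: "P \<in> M \<rightarrow>\<^sub>M prob_algebra M"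
  have "P x \<in> space (prob_algebra M)" if "x \<in> space M" for x
    using P that by (rule measurable_space)
  moreover have "(\<lambda>x. measure (P x) A) \<in> borel_measurable M" if "A \<in> sets M" for A
    unfolding measure_def
    using measurable_compose[OF measurable_prob_algebraD[OF P] measurable_emeasure_subprob_algebra[OF that]]
    by measurable
  ultimately show "markov_kernel M P"
    by (auto simp: markov_kernel_def space_prob_algebra)
qed

text \<open>
  For a measure \<open>\<kappa>\<close> on \<open>M\<close>, the measure \<open>\<kappa>P\<close> is the monadic bind \<open>\<kappa> \<bind> P\<close>.
\<close>

primrec kernel_power :: "'a measure \<Rightarrow> ('a \<Rightarrow> 'a measure) \<Rightarrow> nat \<Rightarrow> 'a \<Rightarrow> 'a measure" where
  "kernel_power M P 0 = return M"
| "kernel_power M P (Suc n) = (\<lambda>x. kernel_power M P n x \<bind> P)"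

text \<open>
  Total variation of a real set function: the supremum over finite measurable partitions.
  It is applied to the difference of two probability measures.
\<close>

definition tv_norm :: "'a measure \<Rightarrow> ('a set \<Rightarrow> real) \<Rightarrow> ennreal" where
  "tv_norm M \<nu> =
     (SUP \<P> \<in> {\<P>. finite \<P> \<and> \<P> \<subseteq> sets M \<and> partition_on (space M) \<P>}.
        \<Sum>A\<in>\<P>. ennreal \<bar>\<nu> A\<bar>)"

definition kernel_tilde :: "'a measure \<Rightarrow> ('a \<Rightarrow> 'a measure) \<Rightarrow> 'a \<Rightarrow> 'a set \<Rightarrow> ennreal" where
  "kernel_tilde M P x A = (\<Sum>n. ennreal (1 / 2 ^ (n + 1)) * emeasure (kernel_power M P n x) A)"

text \<open>
  Functions on \<open>M\<close> are represented by total functions on the carrier type; their values outside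
  \<open>space M\<close> are unconstrained.
\<close>

definition bounded_harmonic :: "'a measure \<Rightarrow> ('a \<Rightarrow> 'a measure) \<Rightarrow> ('a \<Rightarrow> real) set" where
  "bounded_harmonic M P =
     {h. h \<in> borel_measurable M \<and> bounded (h ` space M) \<and>
         (\<forall>x\<in>space M. h x = (\<integral>y. h y \<partial>P x))}"

end

theory Submission
  imports Defs
begin

text \<open>
  Let \<open>h\<close> be bounded and \<open>P\<close>-harmonic and put \<open>g = Qh\<close>. Asymptotic commutation gives
  \<open>P\<^sup>t g \<longlonglongrightarrow> g\<close> pointwise, hence \<open>Pg = g\<close> by dominated convergence, so \<open>f = g - h\<close> is
  \<open>P\<close>-harmonic and \<open>f\<^sup>2\<close> is \<open>P\<close>-subharmonic. Let \<open>R\<close> be the geometric mixture of the powers of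
  \<open>P\<close>. By Jensen and \<open>Q \<le> c R\<close>, \<open>f(x)\<^sup>2\<close> is at most \<open>c\<close> times the variance of \<open>h\<close> under
  \<open>R\<^sub>x\<close>, that is \<open>f\<^sup>2 \<le> c (R h\<^sup>2 - h\<^sup>2)\<close>. Applying \<open>P\<^sup>t\<close>,
  \<open>f\<^sup>2 \<le> P\<^sup>t f\<^sup>2 \<le> c (R P\<^sup>t h\<^sup>2 - P\<^sup>t h\<^sup>2)\<close>; since \<open>P\<^sup>t h\<^sup>2\<close> is increasing in \<open>t\<close> and
  bounded, the right-hand side tends to 0.
\<close>

section \<open>Integrals of bounded functions against probability measures and kernels\<close>

lemma kernel_space:
  assumes "K \<in> M \<rightarrow>\<^sub>M prob_algebra N" "x \<in> space M"
  shows "prob_space (K x)" "sets (K x) = sets N" "space (K x) = space N"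
  using measurable_space[OF assms] by (auto simp: space_prob_algebra dest: sets_eq_imp_space_eq)

lemma integrable_bounded_prob:
  fixes u :: "'a \<Rightarrow> real"
  assumes "prob_space \<mu>" "sets \<mu> = sets M" "u \<in> borel_measurable M"
    and "\<And>y. y \<in> space M \<Longrightarrow> \<bar>u y\<bar> \<le> B"
  shows "integrable \<mu> u"
proof -
  interpret prob_space \<mu> by fact
  show ?thesis
    using assms sets_eq_imp_space_eq[OF assms(2)] measurable_cong_sets[OF assms(2) refl]
    by (intro integrable_const_bound[where B=B]) (auto intro!: AE_I2)
qed

lemma integral_abs_le_prob:
  fixes u :: "'a \<Rightarrow> real"
  assumes "prob_space \<mu>" "sets \<mu> = sets M" "u \<in> borel_measurable M"
    and "\<And>y. y \<in> space M \<Longrightarrow> \<bar>u y\<bar> \<le> B"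
  shows "\<bar>\<integral>y. u y \<partial>\<mu>\<bar> \<le> B"
proof -
  interpret prob_space \<mu> by fact
  have u: "integrable \<mu> u" by (rule integrable_bounded_prob[OF assms])
  have bd: "- B \<le> u y \<and> u y \<le> B" if "y \<in> space \<mu>" for y
    using assms(4)[of y] that sets_eq_imp_space_eq[OF assms(2)] by auto
  have "(\<integral>y. u y \<partial>\<mu>) \<le> B"
    by (rule integral_le_const[OF u]) (use bd in \<open>auto intro!: AE_I2\<close>)
  moreover have "- B \<le> (\<integral>y. u y \<partial>\<mu>)"
    by (rule integral_ge_const[OF u]) (use bd in \<open>auto intro!: AE_I2\<close>)
  ultimately show ?thesis by auto
qed

text \<open>Jensen's inequality for the square: the right side minus the left side is the variance
  of \<open>u\<close>, which is nonnegative.\<close>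

lemma power2_integral_le_prob:
  fixes u :: "'a \<Rightarrow> real"
  assumes "prob_space \<mu>" "integrable \<mu> u" "integrable \<mu> (\<lambda>y. (u y)\<^sup>2)"
  shows "(\<integral>y. u y \<partial>\<mu>)\<^sup>2 \<le> (\<integral>y. (u y)\<^sup>2 \<partial>\<mu>)"
  using prob_space.variance_eq[OF assms] prob_space.variance_positive[OF assms(1), of u] by simp

lemma power2_bounded:
  fixes r :: real
  shows "\<bar>r\<bar> \<le> B \<Longrightarrow> \<bar>r\<^sup>2\<bar> \<le> B\<^sup>2"
  by (metis abs_ge_zero abs_power2 power2_abs power_mono)

lemma borel_measurable_kernel_integral:
  fixes u :: "'b \<Rightarrow> real"
  assumes "K \<in> M \<rightarrow>\<^sub>M prob_algebra N" "u \<in> borel_measurable N"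
  shows "(\<lambda>x. \<integral>y. u y \<partial>K x) \<in> borel_measurable M"
  by (rule measurable_compose[OF measurable_prob_algebraD[OF assms(1)]
        integral_measurable_subprob_algebra[OF assms(2)]])

lemma integral_bind_kernel:
  fixes u :: "'b \<Rightarrow> real"
  assumes "prob_space \<mu>" "sets \<mu> = sets M" "K \<in> M \<rightarrow>\<^sub>M prob_algebra N"
    and "u \<in> borel_measurable N" "\<And>y. y \<in> space N \<Longrightarrow> \<bar>u y\<bar> \<le> B"
  shows "(\<integral>y. u y \<partial>(\<mu> \<bind> K)) = (\<integral>x. (\<integral>y. u y \<partial>K x) \<partial>\<mu>)"
\<comment> \<open>\<open>B'\<close> bounds the total mass of the measures \<open>K x\<close>, which
  is 1 for a Markov kernel.\<close>
proof (rule integral_bind[where K=N and B=B and B'=1])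
  show "K \<in> \<mu> \<rightarrow>\<^sub>M subprob_algebra N"
    using measurable_prob_algebraD[OF assms(3)] measurable_cong_sets[OF assms(2) refl] by auto
  show "finite_measure \<mu>" using assms(1) by (simp add: prob_space_def)
  show "AE x in \<mu>. emeasure (K x) (space (K x)) \<le> ennreal 1"
    using kernel_space(1)[OF assms(3)] sets_eq_imp_space_eq[OF assms(2)]
    by (auto intro!: AE_I2 simp: prob_space.emeasure_space_1)
qed (use assms in auto)

subsection \<open>Powers of a kernel\<close>

lemma measurable_kernel_power:
  assumes "P \<in> M \<rightarrow>\<^sub>M prob_algebra M"
  shows "kernel_power M P n \<in> M \<rightarrow>\<^sub>M prob_algebra M"
  using assms by (induction n) (auto intro: measurable_bind_prob_space)

lemma kernel_power_1:
  assumes "P \<in> M \<rightarrow>\<^sub>M prob_algebra M" "x \<in> space M"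
  shows "kernel_power M P (Suc 0) x = P x"
  using bind_return[OF measurable_prob_algebraD[OF assms(1)] assms(2)] by simp

text \<open>The Chapman-Kolmogorov identity, tested on bounded functions.
  \<open>kernel_power\<close> appends each new step on the right, so the last step can be absorbed
  into the integrand, replacing \<open>u\<close> by \<open>?v\<close>; this is why the induction on
  \<open>n\<close> leaves \<open>u\<close> arbitrary.\<close>

lemma integral_kernel_power_add:
  fixes u :: "'a \<Rightarrow> real"
  assumes P: "P \<in> M \<rightarrow>\<^sub>M prob_algebra M" and x: "x \<in> space M"
    and "u \<in> borel_measurable M" "\<And>y. y \<in> space M \<Longrightarrow> \<bar>u y\<bar> \<le> B"
  shows "(\<integral>y. (\<integral>z. u z \<partial>kernel_power M P n y) \<partial>kernel_power M P t x)
       = (\<integral>z. u z \<partial>kernel_power M P (t + n) x)"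
  using assms(3,4)
proof (induction n arbitrary: u)
  case 0
  note K = kernel_space[OF measurable_kernel_power[OF P] x, of t]
  show ?case
    by (auto intro!: Bochner_Integration.integral_cong simp: K integral_return 0)
next
  case (Suc n)
  note PW = measurable_kernel_power[OF P]
  note K = kernel_space[OF PW x]
  let ?v = "\<lambda>y. \<integral>z. u z \<partial>P y"
  have v: "?v \<in> borel_measurable M" by (rule borel_measurable_kernel_integral[OF P Suc.prems(1)])
  have vb: "\<bar>?v y\<bar> \<le> B" if "y \<in> space M" for y
    using integral_abs_le_prob[OF kernel_space(1,2)[OF P that] Suc.prems] .
  have *: "(\<integral>z. u z \<partial>kernel_power M P (Suc k) y) = (\<integral>z. ?v z \<partial>kernel_power M P k y)"
    if "y \<in> space M" for y k
    using integral_bind_kernel[OF kernel_space(1,2)[OF PW that] P Suc.prems] by simp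
  have "(\<integral>y. (\<integral>z. u z \<partial>kernel_power M P (Suc n) y) \<partial>kernel_power M P t x)
      = (\<integral>y. (\<integral>z. ?v z \<partial>kernel_power M P n y) \<partial>kernel_power M P t x)"
    by (rule Bochner_Integration.integral_cong[OF refl]) (rule *, simp add: K)
  also have "\<dots> = (\<integral>z. ?v z \<partial>kernel_power M P (t + n) x)"
    by (rule Suc.IH[OF v vb])
  also have "\<dots> = (\<integral>z. u z \<partial>kernel_power M P (t + Suc n) x)"
    using *[OF x, of "t + n"] by simp
  finally show ?case .
qed

text \<open>Each induction step integrates out the last application of \<open>P\<close>, which turns
  \<open>h\<close> into itself.\<close>

lemma harmonic_kernel_power:
  fixes h :: "'a \<Rightarrow> real"
  assumes P: "P \<in> M \<rightarrow>\<^sub>M prob_algebra M"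
    and h: "h \<in> borel_measurable M" "\<And>y. y \<in> space M \<Longrightarrow> \<bar>h y\<bar> \<le> B"
    and harm: "\<And>y. y \<in> space M \<Longrightarrow> h y = (\<integral>z. h z \<partial>P y)"
    and x: "x \<in> space M"
  shows "(\<integral>y. h y \<partial>kernel_power M P n x) = h x"
proof (induction n)
  case 0
  show ?case using h x by (simp add: integral_return)
next
  case (Suc n)
  note K = kernel_space[OF measurable_kernel_power[OF P] x, of n]
  have "(\<integral>y. h y \<partial>kernel_power M P (Suc n) x) = (\<integral>y. (\<integral>z. h z \<partial>P y) \<partial>kernel_power M P n x)"
    using integral_bind_kernel[OF K(1,2) P h] by simp
  also have "\<dots> = (\<integral>y. h y \<partial>kernel_power M P n x)"
    by (rule Bochner_Integration.integral_cong[OF refl]) (simp add: K harm[symmetric])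
  finally show ?case using Suc by simp
qed

subsection \<open>Total variation\<close>

text \<open>\<open>A\<close> and its complement are one of the partitions in the supremum. Blocks of
  a partition are nonempty, so an empty one is dropped from \<open>?\<P>\<close>, and
  \<open>A = {}\<close> is settled by \<open>\<nu> {} = 0\<close>.\<close>

lemma abs_le_tv_norm:
  assumes "A \<in> sets M" "\<nu> {} = 0"
  shows "ennreal \<bar>\<nu> A\<bar> \<le> tv_norm M \<nu>"
proof (cases "A = {}")
  case False
  let ?\<P> = "{A, space M - A} - {{}}"
  have A: "A \<subseteq> space M" using assms(1) by (rule sets.sets_into_space)
  have "ennreal \<bar>\<nu> A\<bar> \<le> (\<Sum>B\<in>?\<P>. ennreal \<bar>\<nu> B\<bar>)"
    using False by (intro member_le_sum) auto
  also have "\<dots> \<le> tv_norm M \<nu>"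
    unfolding tv_norm_def
    by (rule SUP_upper) (use A assms(1) in \<open>auto simp: partition_on_def disjoint_def\<close>)
  finally show ?thesis .
qed (use assms in simp)

text \<open>The sum counts the positive integers up to \<open>y\<close>; as \<open>y\<close> is at
  most \<open>N\<close>, cutting the range at \<open>N\<close> loses none of them.\<close>

lemma sum_of_bool_le_eq_floor:
  fixes y :: real
  assumes "0 \<le> y" "y \<le> real N"
  shows "(\<Sum>k=1..N. of_bool (real k \<le> y)) = real (nat \<lfloor>y\<rfloor>)"
proof -
  have "{1..N} \<inter> {k. real k \<le> y} = {1..nat \<lfloor>y\<rfloor>}"
    using assms by (auto simp: le_nat_iff le_floor_iff)
  then show ?thesis by (simp add: of_bool_def sum.If_cases)
qed

text \<open>A function with values in the unit interval is within \<open>1/N\<close> of the average of the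
  indicators of its superlevel sets \<open>{u \<ge> k/N}\<close>, \<open>1 \<le> k \<le> N\<close>.\<close>

lemma integral_diff_le_unit:
  fixes u :: "'a \<Rightarrow> real"
  assumes \<mu>: "prob_space \<mu>" "sets \<mu> = sets M" and \<nu>: "prob_space \<nu>" "sets \<nu> = sets M"
    and u: "u \<in> borel_measurable M" "\<And>y. y \<in> space M \<Longrightarrow> 0 \<le> u y \<and> u y \<le> 1"
    and d: "\<And>A. A \<in> sets M \<Longrightarrow> \<bar>measure \<mu> A - measure \<nu> A\<bar> \<le> d"
  shows "\<bar>(\<integral>y. u y \<partial>\<mu>) - (\<integral>y. u y \<partial>\<nu>)\<bar> \<le> d"
proof -
  note [measurable] = u(1)
  \<comment> \<open>Replacing \<open>u\<close> by the step function \<open>s\<close> costs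
    \<open>1 / real N\<close> under each of the two measures. The integrals of \<open>s\<close>
    differ by an average of \<open>N\<close> differences of measures of sets, hence by at most
    \<open>d\<close>.\<close>
  have le: "\<bar>(\<integral>y. u y \<partial>\<mu>) - (\<integral>y. u y \<partial>\<nu>)\<bar> \<le> d + 2 / real N" if N: "N > 0" for N
  proof -
    define A where "A k = {y \<in> space M. real k \<le> real N * u y}" for k
    have A[measurable]: "A k \<in> sets M" for k unfolding A_def by measurable
    define s where "s y = (\<Sum>k=1..N. indicator (A k) y) / real N" for y
    have s: "s \<in> borel_measurable M" unfolding s_def by measurable
    have close: "\<bar>u y - s y\<bar> \<le> 1 / real N" if y: "y \<in> space M" for y
    proof -
      have "(\<Sum>k=1..N. indicator (A k) y) = (\<Sum>k=1..N. of_bool (real k \<le> real N * u y) :: real)"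
        using y by (intro sum.cong) (auto simp: A_def indicator_def)
      also have "\<dots> = real (nat \<lfloor>real N * u y\<rfloor>)"
        using u(2)[OF y] by (intro sum_of_bool_le_eq_floor) (auto simp: mult_left_le)
      finally have "s y = real (nat \<lfloor>real N * u y\<rfloor>) / real N" by (simp add: s_def)
      moreover have "\<bar>real N * u y - real (nat \<lfloor>real N * u y\<rfloor>)\<bar> \<le> 1"
        using u(2)[OF y] by (simp add: of_nat_nat abs_le_iff) linarith
      ultimately show ?thesis
        using N by (simp add: abs_le_iff field_simps)
    qed
    have approx: "\<bar>(\<integral>y. u y \<partial>\<kappa>) - (\<Sum>k=1..N. measure \<kappa> (A k)) / real N\<bar> \<le> 1 / real N"
      if \<kappa>: "prob_space \<kappa>" "sets \<kappa> = sets M" for \<kappa>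
    proof -
      interpret prob_space \<kappa> by fact
      have Ak: "A k \<in> sets \<kappa>" for k using \<kappa> A by simp
      have iu: "integrable \<kappa> u"
        by (rule integrable_bounded_prob[OF \<kappa> u(1), where B=1]) (use u(2) in force)
      have is_int: "integrable \<kappa> s" unfolding s_def using Ak
        by (intro integrable_divide_zero Bochner_Integration.integrable_sum integrable_real_indicator)
           (auto simp: less_top[symmetric])
      have "(\<integral>y. s y \<partial>\<kappa>) = (\<Sum>k=1..N. measure \<kappa> (A k)) / real N"
        unfolding s_def integral_divide_zero using Ak
        by (subst Bochner_Integration.integral_sum) (auto simp: less_top[symmetric])
      moreover have "\<bar>\<integral>y. u y - s y \<partial>\<kappa>\<bar> \<le> 1 / real N"
        by (rule integral_abs_le_prob[OF \<kappa> _ close]) (use s in measurable)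
      ultimately show ?thesis using iu is_int by simp
    qed
    have "\<bar>(\<Sum>k=1..N. measure \<mu> (A k)) / real N - (\<Sum>k=1..N. measure \<nu> (A k)) / real N\<bar>
        = \<bar>\<Sum>k=1..N. measure \<mu> (A k) - measure \<nu> (A k)\<bar> / real N"
      by (simp add: sum_subtractf diff_divide_distrib[symmetric])
    also have "\<dots> \<le> (\<Sum>k=1..N. d) / real N"
      by (intro divide_right_mono order_trans[OF sum_abs] sum_mono d A) auto
    also have "\<dots> = d" using N by simp
    finally show ?thesis
      using approx[OF \<mu>] approx[OF \<nu>] by linarith
  qed
  have "(\<lambda>N. d + 2 / real N) \<longlonglongrightarrow> d + 0"
    by (intro tendsto_intros lim_const_over_n)
  then show ?thesis
    using le by (intro LIMSEQ_le_const[where x="d"]) (auto intro!: exI[of _ 1])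
qed

text \<open>An affine change of scale brings \<open>u\<close> into the unit interval, where the
  integrals differ by no more than the measures do on single sets, and \<open>tv_norm\<close>
  controls the latter.\<close>

lemma integral_diff_tendsto_0:
  fixes u :: "'a \<Rightarrow> real"
  assumes \<mu>: "\<And>t. prob_space (\<mu> t)" "\<And>t. sets (\<mu> t) = sets M"
    and \<nu>: "\<And>t. prob_space (\<nu> t)" "\<And>t. sets (\<nu> t) = sets M"
    and u: "u \<in> borel_measurable M" "\<And>y. y \<in> space M \<Longrightarrow> \<bar>u y\<bar> \<le> B"
    and lim: "(\<lambda>t::nat. tv_norm M (\<lambda>A. measure (\<mu> t) A - measure (\<nu> t) A)) \<longlonglongrightarrow> 0"
  shows "(\<lambda>t. (\<integral>y. u y \<partial>\<mu> t) - (\<integral>y. u y \<partial>\<nu> t)) \<longlonglongrightarrow> 0"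
proof (rule LIMSEQ_I)
  fix e :: real assume e: "0 < e"
  \<comment> \<open>The rescaling divides by \<open>2 * C\<close>, so the bound is enlarged to be
    strictly positive.\<close>
  define C where "C = \<bar>B\<bar> + 1"
  have C: "C > 0" "\<And>y. y \<in> space M \<Longrightarrow> \<bar>u y\<bar> \<le> C" using u(2) by (fastforce simp: C_def)+
  define v where "v y = (u y + C) / (2 * C)" for y
  have v: "v \<in> borel_measurable M" unfolding v_def using u(1) by measurable
  have vb: "0 \<le> v y \<and> v y \<le> 1" if "y \<in> space M" for y
    using C(1) C(2)[OF that] by (auto simp: v_def field_simps abs_le_iff)
  have v_int: "(\<integral>y. v y \<partial>\<kappa>) = ((\<integral>y. u y \<partial>\<kappa>) + C) / (2 * C)"
    if \<kappa>: "prob_space \<kappa>" "sets \<kappa> = sets M" for \<kappa>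
  proof -
    interpret prob_space \<kappa> by fact
    have "integrable \<kappa> u" by (rule integrable_bounded_prob[OF \<kappa> u(1) C(2)])
    then show ?thesis by (simp add: v_def prob_space)
  qed
  \<comment> \<open>Undoing the rescaling multiplies by \<open>2 * C\<close>, so this threshold
    gives \<open>e / 2\<close>, strictly below \<open>e\<close>.\<close>
  have "eventually (\<lambda>t. tv_norm M (\<lambda>A. measure (\<mu> t) A - measure (\<nu> t) A) < ennreal (e / (4 * C)))
      sequentially"
    using e C(1) by (intro order_tendstoD(2)[OF lim]) simp
  then obtain T where T: "\<And>t. t \<ge> T \<Longrightarrow>
      tv_norm M (\<lambda>A. measure (\<mu> t) A - measure (\<nu> t) A) < ennreal (e / (4 * C))"
    by (auto simp: eventually_sequentially)
  show "\<exists>T. \<forall>t\<ge>T. norm ((\<integral>y. u y \<partial>\<mu> t) - (\<integral>y. u y \<partial>\<nu> t) - 0) < e"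
  proof (intro exI[of _ T] allI impI)
    fix t assume t: "T \<le> t"
    have "\<bar>measure (\<mu> t) A - measure (\<nu> t) A\<bar> \<le> e / (4 * C)" if "A \<in> sets M" for A
    proof -
      have "ennreal \<bar>measure (\<mu> t) A - measure (\<nu> t) A\<bar> \<le> ennreal (e / (4 * C))"
        using abs_le_tv_norm[of A M "\<lambda>A. measure (\<mu> t) A - measure (\<nu> t) A"] T[OF t] that
        by (auto dest: order.strict_trans1)
      then show ?thesis using e C(1) by (subst (asm) ennreal_le_iff) auto
    qed
    from integral_diff_le_unit[OF \<mu>(1,2) \<nu>(1,2) v vb this]
    have "\<bar>((\<integral>y. u y \<partial>\<mu> t) + C) / (2 * C) - ((\<integral>y. u y \<partial>\<nu> t) + C) / (2 * C)\<bar> \<le> e / (4 * C)"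
      by (simp add: v_int \<mu> \<nu>)
    also have "((\<integral>y. u y \<partial>\<mu> t) + C) / (2 * C) - ((\<integral>y. u y \<partial>\<nu> t) + C) / (2 * C)
        = ((\<integral>y. u y \<partial>\<mu> t) - (\<integral>y. u y \<partial>\<nu> t)) / (2 * C)"
      by (simp add: diff_divide_distrib add_divide_distrib)
    finally have "\<bar>(\<integral>y. u y \<partial>\<mu> t) - (\<integral>y. u y \<partial>\<nu> t)\<bar> \<le> e / 2"
      using C(1) by (simp add: abs_mult field_simps)
    then show "norm ((\<integral>y. u y \<partial>\<mu> t) - (\<integral>y. u y \<partial>\<nu> t) - 0) < e"
      using e by simp
  qed
qed

subsection \<open>The geometric mixture\<close>

text \<open>Passes from domination on sets to domination of integrals. Writing
  \<open>kernel_tilde\<close> as a bind over a \<open>pmf\<close> makes it an actual probability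
  measure \<open>?R\<close>, whose integrals unfold into averages over the powers.\<close>

lemma integral_le_geometric_mixture:
  fixes u :: "'a \<Rightarrow> real"
  assumes P: "P \<in> M \<rightarrow>\<^sub>M prob_algebra M" and x: "x \<in> space M"
    and \<mu>: "prob_space \<mu>" "sets \<mu> = sets M" and c: "0 \<le> c"
    and dom: "\<And>A. A \<in> sets M \<Longrightarrow> emeasure \<mu> A \<le> ennreal c * kernel_tilde M P x A"
    and u: "u \<in> borel_measurable M" "\<And>y. y \<in> space M \<Longrightarrow> 0 \<le> u y \<and> u y \<le> B"
  shows "(\<integral>y. u y \<partial>\<mu>) \<le> c * (\<integral>n. (\<integral>y. u y \<partial>kernel_power M P n x) \<partial>geometric_pmf (1/2))"
proof -
  let ?w = "measure_pmf (geometric_pmf (1/2))"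
  let ?k = "\<lambda>n. kernel_power M P n x"
  let ?R = "?w \<bind> ?k"
  note K = kernel_space[OF measurable_kernel_power[OF P] x]
  have k: "?k \<in> count_space UNIV \<rightarrow>\<^sub>M prob_algebra M"
    using K by (simp add: space_prob_algebra)
  have k': "?k \<in> ?w \<rightarrow>\<^sub>M subprob_algebra M"
    using measurable_prob_algebraD[OF k] by simp
  have R: "prob_space ?R" "sets ?R = sets M"
    using measure_pmf.prob_space_bind[OF _ k'] K by auto
  have ub: "\<bar>u y\<bar> \<le> B" if "y \<in> space M" for y using u(2)[OF that] by auto
  \<comment> \<open>\<open>geometric_pmf (1/2)\<close> starts at 0 and gives \<open>n\<close> the
    mass \<open>1 / 2 ^ (n + 1)\<close>, which is exactly the weight in
    \<open>kernel_tilde\<close>.\<close>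
  have tilde: "emeasure ?R A = kernel_tilde M P x A" if "A \<in> sets M" for A
  proof -
    have "emeasure ?R A = (\<integral>\<^sup>+n. emeasure (?k n) A \<partial>?w)"
      by (rule emeasure_bind[OF _ k' that]) simp
    also have "\<dots> = kernel_tilde M P x A"
      by (simp add: nn_integral_measure_pmf nn_integral_count_space_nat kernel_tilde_def
          power_one_over mult.commute)
    finally show ?thesis .
  qed
  \<comment> \<open>The order on measures compares \<open>emeasure\<close> on all sets; outside the
    sigma-algebra both sides are 0.\<close>
  have "\<mu> \<le> scale_measure (ennreal c) ?R"
    using \<mu> R dom tilde sets_eq_imp_space_eq[OF \<mu>(2)] sets_eq_imp_space_eq[OF R(2)]
    by (auto simp: le_measure_iff space_scale_measure le_fun_def)
       (metis emeasure_notin_sets zero_le)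
  then have "(\<integral>\<^sup>+y. u y \<partial>\<mu>) \<le> (\<integral>\<^sup>+y. u y \<partial>scale_measure (ennreal c) ?R)"
    using \<mu> R by (intro nn_integral_mono_measure) auto
  also have "\<dots> = ennreal c * (\<integral>\<^sup>+y. u y \<partial>?R)"
    using u(1) by (intro nn_integral_scale_measure measurable_compose[OF _ measurable_ennreal])
      (simp add: measurable_cong_sets[OF R(2) refl])
  also have "(\<integral>\<^sup>+y. u y \<partial>?R) = ennreal (\<integral>y. u y \<partial>?R)"
    using sets_eq_imp_space_eq[OF R(2)] u
    by (intro nn_integral_eq_integral integrable_bounded_prob[OF R u(1) ub]) (auto intro!: AE_I2)
  also have "(\<integral>\<^sup>+y. u y \<partial>\<mu>) = ennreal (\<integral>y. u y \<partial>\<mu>)"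
    using sets_eq_imp_space_eq[OF \<mu>(2)] u
    by (intro nn_integral_eq_integral integrable_bounded_prob[OF \<mu> u(1) ub]) (auto intro!: AE_I2)
  finally have "ennreal (\<integral>y. u y \<partial>\<mu>) \<le> ennreal (c * (\<integral>y. u y \<partial>?R))"
    using c by (simp add: ennreal_mult')
  moreover have "0 \<le> (\<integral>y. u y \<partial>?R)"
    using sets_eq_imp_space_eq[OF R(2)] u by (intro Bochner_Integration.integral_nonneg_AE AE_I2) auto
  ultimately have "(\<integral>y. u y \<partial>\<mu>) \<le> c * (\<integral>y. u y \<partial>?R)"
    using c by (simp add: ennreal_le_iff)
  also have "(\<integral>y. u y \<partial>?R) = (\<integral>n. (\<integral>y. u y \<partial>?k n) \<partial>?w)"
    by (rule integral_bind_kernel[OF _ _ k u(1) ub]) (auto simp: measure_pmf.prob_space_axioms)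
  finally show ?thesis .
qed

text \<open>Fubini's theorem on a product of probability spaces. Joint measurability follows from
  that of each \<open>F n\<close> because the index ranges over a countable type.\<close>

lemma integral_measure_pmf_swap:
  fixes F :: "nat \<Rightarrow> 'a \<Rightarrow> real"
  assumes \<mu>: "prob_space \<mu>" and F: "\<And>n. F n \<in> borel_measurable \<mu>"
    and B: "\<And>n y. y \<in> space \<mu> \<Longrightarrow> \<bar>F n y\<bar> \<le> B"
  shows "(\<integral>y. (\<integral>n. F n y \<partial>measure_pmf w) \<partial>\<mu>) = (\<integral>n. (\<integral>y. F n y \<partial>\<mu>) \<partial>measure_pmf w)"
    and "(\<lambda>y. \<integral>n. F n y \<partial>measure_pmf w) \<in> borel_measurable \<mu>"
proof -
  interpret prob_space \<mu> by fact
  interpret pair_prob_space "measure_pmf w" \<mu> ..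
  have m: "(\<lambda>(n, y). F n y) \<in> borel_measurable (measure_pmf w \<Otimes>\<^sub>M \<mu>)"
    using measurable_pair_measure_countable1[of UNIV "\<lambda>(n, y). F n y" \<mu> borel] F
    by (simp cong: measurable_cong_sets sets_pair_measure_cong)
  have "integrable (measure_pmf w \<Otimes>\<^sub>M \<mu>) (\<lambda>(n, y). F n y)"
    by (rule P.integrable_const_bound[where B=B, OF _ m])
       (use B in \<open>auto intro!: AE_I2 simp: space_pair_measure\<close>)
  then show "(\<integral>y. (\<integral>n. F n y \<partial>measure_pmf w) \<partial>\<mu>) = (\<integral>n. (\<integral>y. F n y \<partial>\<mu>) \<partial>measure_pmf w)"
    by (rule Fubini_integral)
  show "(\<lambda>y. \<integral>n. F n y \<partial>measure_pmf w) \<in> borel_measurable \<mu>"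
    using measurable_pair_swap[OF m]
    by (intro measure_pmf.borel_measurable_lebesgue_integral) (simp add: split_beta')
qed

text \<open>A bounded monotone sequence has a limit \<open>L\<close>. Every shifted sequence has the
  same limit, so by dominated convergence the average over \<open>n\<close> also tends to
  \<open>L\<close>.\<close>

lemma integral_pmf_shift_tendsto_0:
  fixes a :: "nat \<Rightarrow> real"
  assumes "incseq a" "\<And>t. \<bar>a t\<bar> \<le> B"
  shows "(\<lambda>t. (\<integral>n. a (t + n) \<partial>measure_pmf w) - a t) \<longlonglongrightarrow> 0"
proof -
  have "convergent a"
    using assms by (intro Bseq_mono_convergent BseqI'[where K=B]) (auto simp: incseq_def)
  then obtain L where L: "a \<longlonglongrightarrow> L" by (auto simp: convergent_def)
  have "(\<lambda>t. \<integral>n. a (t + n) \<partial>measure_pmf w) \<longlonglongrightarrow> (\<integral>n. L \<partial>measure_pmf w)"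
    by (rule integral_dominated_convergence[where w="\<lambda>_. B"])
       (use assms(2) LIMSEQ_ignore_initial_segment[OF L] in auto)
  from tendsto_diff[OF this L] show ?thesis by simp
qed

subsection \<open>Harmonic functions\<close>

text \<open>Since \<open>h\<close> is \<open>P\<close>-harmonic, integrating it after
  \<open>Q\<close> and then \<open>t\<close> steps of \<open>P\<close> gives \<open>g\<close> for
  every \<open>t\<close>. The commutation hypothesis therefore says that integrals of
  \<open>g\<close> against the powers of \<open>P\<close> converge back to \<open>g\<close>.\<close>

lemma harmonic_kernel_image:
  fixes h :: "'a \<Rightarrow> real"
  assumes P: "P \<in> M \<rightarrow>\<^sub>M prob_algebra M" and Q: "Q \<in> M \<rightarrow>\<^sub>M prob_algebra M"
    and lim: "\<And>x. x \<in> space M \<Longrightarrow>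
      (\<lambda>t. tv_norm M (\<lambda>A. measure (return M x \<bind> kernel_power M P t \<bind> Q) A
                        - measure (return M x \<bind> Q \<bind> kernel_power M P t) A))
        \<longlonglongrightarrow> 0"
    and h: "h \<in> borel_measurable M" "\<And>y. y \<in> space M \<Longrightarrow> \<bar>h y\<bar> \<le> B"
    and harm: "\<And>y. y \<in> space M \<Longrightarrow> h y = (\<integral>z. h z \<partial>P y)"
    and x: "x \<in> space M"
  shows "(\<integral>z. h z \<partial>Q x) = (\<integral>y. (\<integral>z. h z \<partial>Q y) \<partial>P x)"
proof -
  define g where "g y = (\<integral>z. h z \<partial>Q y)" for y
  note PW = measurable_kernel_power[OF P]
  have g: "g \<in> borel_measurable M"
    unfolding g_def by (rule borel_measurable_kernel_integral[OF Q h(1)])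
  have gb: "\<bar>g y\<bar> \<le> B" if "y \<in> space M" for y
    unfolding g_def by (rule integral_abs_le_prob[OF kernel_space(1,2)[OF Q that] h])
  have conv: "(\<lambda>t. \<integral>z. g z \<partial>kernel_power M P t y) \<longlonglongrightarrow> g y" if y: "y \<in> space M" for y
  proof -
    let ?\<mu> = "\<lambda>t. kernel_power M P t y \<bind> Q" and ?\<nu> = "\<lambda>t. Q y \<bind> kernel_power M P t"
    have \<mu>: "prob_space (?\<mu> t)" "sets (?\<mu> t) = sets M" for t
      using kernel_space[OF measurable_bind_prob_space[OF PW Q] y] by blast+
    have \<nu>: "prob_space (?\<nu> t)" "sets (?\<nu> t) = sets M" for t
      using kernel_space[OF measurable_bind_prob_space[OF Q PW] y] by blast+
    have "(\<lambda>t. tv_norm M (\<lambda>A. measure (?\<mu> t) A - measure (?\<nu> t) A)) \<longlonglongrightarrow> 0"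
      using lim[OF y] y
      by (simp add: bind_return[OF measurable_prob_algebraD[OF Q]]
          bind_return[OF measurable_prob_algebraD[OF PW]])
    from integral_diff_tendsto_0[OF \<mu> \<nu> h this]
    have "(\<lambda>t. (\<integral>z. h z \<partial>?\<mu> t) - (\<integral>z. h z \<partial>?\<nu> t)) \<longlonglongrightarrow> 0" .
    moreover have "(\<integral>z. h z \<partial>?\<mu> t) = (\<integral>z. g z \<partial>kernel_power M P t y)" for t
      unfolding g_def by (rule integral_bind_kernel[OF kernel_space(1,2)[OF PW y] Q h])
    moreover have "(\<integral>z. h z \<partial>?\<nu> t) = g y" for t
    proof -
      have "(\<integral>z. h z \<partial>?\<nu> t) = (\<integral>u. (\<integral>z. h z \<partial>kernel_power M P t u) \<partial>Q y)"
        by (rule integral_bind_kernel[OF kernel_space(1,2)[OF Q y] PW h])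
      also have "\<dots> = g y"
        unfolding g_def
        by (rule Bochner_Integration.integral_cong[OF refl])
           (rule harmonic_kernel_power[OF P h harm], simp_all add: kernel_space[OF Q y])
      finally show ?thesis .
    qed
    ultimately show ?thesis by (simp add: LIM_zero_iff)
  qed
  have Px: "prob_space (P x)" "sets (P x) = sets M" "space (P x) = space M"
    using kernel_space[OF P x] .
  interpret prob_space "P x" by (rule Px)
  \<comment> \<open>Dominated convergence under \<open>P x\<close>; the bound \<open>B\<close> of
    \<open>g\<close> is inherited by its integrals against all powers.\<close>
  have "(\<lambda>t. \<integral>y. (\<integral>z. g z \<partial>kernel_power M P t y) \<partial>P x) \<longlonglongrightarrow> (\<integral>y. g y \<partial>P x)"
  proof (rule integral_dominated_convergence[where w="\<lambda>_. B"])
    show "AE y in P x. (\<lambda>t. \<integral>z. g z \<partial>kernel_power M P t y) \<longlonglongrightarrow> g y"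
      using conv by (intro AE_I2) (simp add: Px)
    show "AE y in P x. norm (\<integral>z. g z \<partial>kernel_power M P t y) \<le> B" for t
      using integral_abs_le_prob[OF kernel_space(1,2)[OF PW] g gb]
      by (intro AE_I2) (simp add: Px)
    show "(\<lambda>y. \<integral>z. g z \<partial>kernel_power M P t y) \<in> borel_measurable (P x)" for t
      using borel_measurable_kernel_integral[OF PW g] by (simp add: measurable_cong_sets[OF Px(2) refl])
    show "g \<in> borel_measurable (P x)"
      using g by (simp add: measurable_cong_sets[OF Px(2) refl])
  qed simp
  \<comment> \<open>These integrals are the sequence of \<open>conv\<close> at \<open>x\<close>,
    shifted by one, so they also tend to \<open>g x\<close>; the two limits must agree.\<close>
  moreover have "(\<integral>y. (\<integral>z. g z \<partial>kernel_power M P t y) \<partial>P x) = (\<integral>z. g z \<partial>kernel_power M P (Suc t) x)" for t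
    using integral_kernel_power_add[OF P x g gb, where t="Suc 0" and n=t]
    by (simp only: kernel_power_1[OF P x] add_Suc add_0)
  ultimately have "(\<lambda>t. \<integral>z. g z \<partial>kernel_power M P (Suc t) x) \<longlonglongrightarrow> (\<integral>y. g y \<partial>P x)"
    by simp
  from LIMSEQ_unique[OF LIMSEQ_Suc[OF conv[OF x]] this] show ?thesis by (simp add: g_def)
qed

text \<open>In the application \<open>\<mu>\<close> is \<open>Q x\<close>. Centring \<open>h\<close>
  at \<open>h x\<close> makes the square on the left the squared mean of \<open>d\<close>. Under
  every power of \<open>P\<close> the mean of \<open>h\<close> is \<open>h x\<close>, so there the
  second moment of \<open>d\<close> is the variance of \<open>h\<close>.\<close>

lemma kernel_deviation_power2_le:
  fixes h :: "'a \<Rightarrow> real"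
  assumes P: "P \<in> M \<rightarrow>\<^sub>M prob_algebra M"
    and h: "h \<in> borel_measurable M" "\<And>y. y \<in> space M \<Longrightarrow> \<bar>h y\<bar> \<le> B"
    and harm: "\<And>y. y \<in> space M \<Longrightarrow> h y = (\<integral>z. h z \<partial>P y)"
    and x: "x \<in> space M"
    and \<mu>: "prob_space \<mu>" "sets \<mu> = sets M" and c: "0 \<le> c"
    and dom: "\<And>A. A \<in> sets M \<Longrightarrow> emeasure \<mu> A \<le> ennreal c * kernel_tilde M P x A"
  shows "((\<integral>y. h y \<partial>\<mu>) - h x)\<^sup>2
    \<le> c * ((\<integral>n. (\<integral>y. (h y)\<^sup>2 \<partial>kernel_power M P n x) \<partial>geometric_pmf (1/2)) - (h x)\<^sup>2)"
proof -
  let ?w = "measure_pmf (geometric_pmf (1/2))"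
  define d where "d y = h y - h x" for y
  note [measurable] = h(1)
  have d: "d \<in> borel_measurable M" "(\<lambda>y. (d y)\<^sup>2) \<in> borel_measurable M"
    unfolding d_def by measurable
  have db: "\<bar>d y\<bar> \<le> 2 * B" if "y \<in> space M" for y
    using h(2)[OF that] h(2)[OF x] unfolding d_def by linarith
  have d2b: "\<bar>(d y)\<^sup>2\<bar> \<le> (2 * B)\<^sup>2" if "y \<in> space M" for y
    using power2_bounded[OF db[OF that]] .
  have h2: "(\<lambda>y. (h y)\<^sup>2) \<in> borel_measurable M" by measurable
  have h2b: "\<bar>(h y)\<^sup>2\<bar> \<le> B\<^sup>2" if "y \<in> space M" for y
    using power2_bounded[OF h(2)[OF that]] .
  have var: "(\<integral>y. (d y)\<^sup>2 \<partial>kernel_power M P n x)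
      = (\<integral>y. (h y)\<^sup>2 \<partial>kernel_power M P n x) - (h x)\<^sup>2" for n
  proof -
    note K = kernel_space[OF measurable_kernel_power[OF P] x, of n]
    interpret K: prob_space "kernel_power M P n x" by (rule K)
    have hx: "(\<integral>y. h y \<partial>kernel_power M P n x) = h x"
      by (rule harmonic_kernel_power[OF P h harm x])
    have "K.variance h = (\<integral>y. (h y)\<^sup>2 \<partial>kernel_power M P n x) - (h x)\<^sup>2"
      using K.variance_eq[OF integrable_bounded_prob[OF K(1,2) h] integrable_bounded_prob[OF K(1,2) h2 h2b]]
      by (simp only: hx)
    then show ?thesis by (simp only: hx d_def)
  qed
  interpret \<mu>: prob_space \<mu> by fact
  have "((\<integral>y. h y \<partial>\<mu>) - h x)\<^sup>2 = (\<integral>y. d y \<partial>\<mu>)\<^sup>2"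
    using integrable_bounded_prob[OF \<mu> h] by (simp add: d_def \<mu>.prob_space)
  also have "\<dots> \<le> (\<integral>y. (d y)\<^sup>2 \<partial>\<mu>)"
    by (intro power2_integral_le_prob \<mu> integrable_bounded_prob[OF \<mu> d(1) db]
        integrable_bounded_prob[OF \<mu> d(2) d2b])
  also have "\<dots> \<le> c * (\<integral>n. (\<integral>y. (d y)\<^sup>2 \<partial>kernel_power M P n x) \<partial>?w)"
    by (rule integral_le_geometric_mixture[OF P x \<mu> c dom d(2), where B="(2 * B)\<^sup>2"])
       (use d2b in auto)
  also have "(\<integral>n. (\<integral>y. (d y)\<^sup>2 \<partial>kernel_power M P n x) \<partial>?w)
      = (\<integral>n. (\<integral>y. (h y)\<^sup>2 \<partial>kernel_power M P n x) \<partial>?w) - (h x)\<^sup>2"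
    unfolding var
  proof (subst Bochner_Integration.integral_diff)
    show "integrable ?w (\<lambda>n. \<integral>y. (h y)\<^sup>2 \<partial>kernel_power M P n x)"
      using integral_abs_le_prob[OF kernel_space(1,2)[OF measurable_kernel_power[OF P] x] h2 h2b]
      by (intro measure_pmf.integrable_const_bound[where B="B\<^sup>2"]) auto
  qed simp_all
  finally show ?thesis .
qed

theorem theorem3p6:
  fixes M :: "'a measure" and P Q :: "'a \<Rightarrow> 'a measure" and c :: real
  assumes "markov_kernel M P" and "markov_kernel M Q"
    and "\<And>x. x \<in> space M \<Longrightarrow>
      (\<lambda>t. tv_norm M (\<lambda>A. measure (return M x \<bind> kernel_power M P t \<bind> Q) A
                        - measure (return M x \<bind> Q \<bind> kernel_power M P t) A))
        \<longlonglongrightarrow> 0"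
    and "c > 0"
    and "\<And>x A. x \<in> space M \<Longrightarrow> A \<in> sets M \<Longrightarrow>
      emeasure (Q x) A \<le> ennreal c * kernel_tilde M P x A"
  shows "bounded_harmonic M P \<subseteq> bounded_harmonic M Q"
proof
  fix h assume "h \<in> bounded_harmonic M P"
  then have h: "h \<in> borel_measurable M" and bdd: "bounded (h ` space M)"
    and harm: "\<And>x. x \<in> space M \<Longrightarrow> h x = (\<integral>y. h y \<partial>P x)"
    by (auto simp: bounded_harmonic_def)
  obtain B where hb: "\<And>y. y \<in> space M \<Longrightarrow> \<bar>h y\<bar> \<le> B"
    using bdd by (auto simp: bounded_iff)
  have P: "P \<in> M \<rightarrow>\<^sub>M prob_algebra M" and Q: "Q \<in> M \<rightarrow>\<^sub>M prob_algebra M"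
    using assms(1,2) by (auto simp: markov_kernel_iff_measurable)
  note PW = measurable_kernel_power[OF P]
  let ?w = "measure_pmf (geometric_pmf (1/2))"
  define g where "g y = (\<integral>z. h z \<partial>Q y)" for y
  define f where "f y = g y - h y" for y
  have g: "g \<in> borel_measurable M"
    unfolding g_def by (rule borel_measurable_kernel_integral[OF Q h])
  have gb: "\<bar>g y\<bar> \<le> B" if "y \<in> space M" for y
    unfolding g_def by (rule integral_abs_le_prob[OF kernel_space(1,2)[OF Q that] h hb])
  have g_harm: "g y = (\<integral>z. g z \<partial>P y)" if "y \<in> space M" for y
    unfolding g_def by (rule harmonic_kernel_image[OF P Q assms(3) h hb harm that])
  note [measurable] = h g
  have f: "f \<in> borel_measurable M" "(\<lambda>y. (f y)\<^sup>2) \<in> borel_measurable M"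
    unfolding f_def by measurable
  have fb: "\<bar>f y\<bar> \<le> 2 * B" if "y \<in> space M" for y
    using gb[OF that] hb[OF that] unfolding f_def by linarith
  have f2b: "\<bar>(f y)\<^sup>2\<bar> \<le> (2 * B)\<^sup>2" if "y \<in> space M" for y
    using power2_bounded[OF fb[OF that]] .
  have h2: "(\<lambda>y. (h y)\<^sup>2) \<in> borel_measurable M" by measurable
  have h2b: "\<bar>(h y)\<^sup>2\<bar> \<le> B\<^sup>2" if "y \<in> space M" for y
    using power2_bounded[OF hb[OF that]] .
  define F where "F n y = (\<integral>z. (h z)\<^sup>2 \<partial>kernel_power M P n y)" for n y
  have F: "F n \<in> borel_measurable M" for n
    unfolding F_def by (rule borel_measurable_kernel_integral[OF PW h2])
  have Fb: "\<bar>F n y\<bar> \<le> B\<^sup>2" if "y \<in> space M" for n y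
    unfolding F_def by (rule integral_abs_le_prob[OF kernel_space(1,2)[OF PW that] h2 h2b])
  have f_le: "(f y)\<^sup>2 \<le> c * ((\<integral>n. F n y \<partial>?w) - (h y)\<^sup>2)" if y: "y \<in> space M" for y
    using kernel_deviation_power2_le[OF P h hb harm y kernel_space(1,2)[OF Q y] _ assms(5)[OF y]]
      assms(4) by (simp add: f_def g_def F_def)
  have "f x = 0" if x: "x \<in> space M" for x
  proof -
    note K = kernel_space[OF PW x]
    have meas: "u \<in> borel_measurable (kernel_power M P t x)"
      if "u \<in> borel_measurable M" for u :: "'a \<Rightarrow> real" and t
      using that by (simp add: measurable_cong_sets[OF K(2) refl])
    have int: "integrable (kernel_power M P t x) u"
      if "u \<in> borel_measurable M" "\<And>y. y \<in> space M \<Longrightarrow> \<bar>u y\<bar> \<le> C" for u :: "'a \<Rightarrow> real" and t C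
      by (rule integrable_bounded_prob[OF K(1,2) that])
    have F_add: "(\<integral>y. F n y \<partial>kernel_power M P t x) = F (t + n) x" for n t
      unfolding F_def by (rule integral_kernel_power_add[OF P x h2 h2b])
    \<comment> \<open>The pointwise bound \<open>f_le\<close> is integrated against \<open>t\<close>
      steps of \<open>P\<close>. The left side can only grow, while on the right each
      \<open>F n\<close> becomes \<open>F (t + n)\<close> and the square of \<open>h\<close> becomes
      \<open>F t\<close>.\<close>
    have bound: "(f x)\<^sup>2 \<le> c * ((\<integral>n. F (t + n) x \<partial>?w) - F t x)" for t
    proof -
      interpret K: prob_space "kernel_power M P t x" by (rule K)
      \<comment> \<open>Exchanging the integrals lets the \<open>t\<close> steps act on each
        \<open>F n\<close> separately.\<close>
      have swap: "(\<integral>y. (\<integral>n. F n y \<partial>?w) \<partial>kernel_power M P t x) = (\<integral>n. F (t + n) x \<partial>?w)"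
        by (subst integral_measure_pmf_swap(1)[where B="B\<^sup>2"])
           (auto simp: K F_add Fb intro: meas F)
      have swap_int: "integrable (kernel_power M P t x) (\<lambda>y. \<integral>n. F n y \<partial>?w)"
      proof (rule K.integrable_const_bound[where B="B\<^sup>2"])
        show "(\<lambda>y. \<integral>n. F n y \<partial>?w) \<in> borel_measurable (kernel_power M P t x)"
          by (rule integral_measure_pmf_swap(2)[where B="B\<^sup>2"]) (auto simp: K Fb intro: meas F)
        show "AE y in kernel_power M P t x. norm (\<integral>n. F n y \<partial>?w) \<le> B\<^sup>2"
          using integral_abs_le_prob[of ?w "count_space UNIV" "\<lambda>n. F n _" "B\<^sup>2"] Fb
          by (intro AE_I2) (simp add: K measure_pmf.prob_space_axioms)
      qed
      \<comment> \<open>Both \<open>g\<close> and \<open>h\<close> are \<open>P\<close>-harmonic,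
        hence each keeps its value at \<open>x\<close> under every power.\<close>
      have "f x = (\<integral>y. f y \<partial>kernel_power M P t x)"
        unfolding f_def
        using harmonic_kernel_power[OF P g gb g_harm x, of t] harmonic_kernel_power[OF P h hb harm x, of t]
          int[OF g gb, of t] int[OF h hb, of t] by simp
      then have "(f x)\<^sup>2 \<le> (\<integral>y. (f y)\<^sup>2 \<partial>kernel_power M P t x)"
        using power2_integral_le_prob[OF K(1) int[OF f(1) fb] int[OF f(2) f2b]] by simp
      also have "\<dots> \<le> (\<integral>y. c * ((\<integral>n. F n y \<partial>?w) - (h y)\<^sup>2) \<partial>kernel_power M P t x)"
        using f_le swap_int int[OF h2 h2b, of t]
        by (intro integral_mono int[OF f(2) f2b]) (auto simp: K)
      also have "\<dots> = c * ((\<integral>n. F (t + n) x \<partial>?w) - F t x)"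
        using swap swap_int int[OF h2 h2b, of t] by (simp add: F_def)
      finally show ?thesis .
    qed
    \<comment> \<open>By Jensen and harmonicity the square of \<open>h\<close> is at most
      \<open>F 1\<close> pointwise; integrating this against \<open>t\<close> steps gives the
      increment from \<open>t\<close> to \<open>Suc t\<close>.\<close>
    have "incseq (\<lambda>t. F t x)"
    proof (rule incseq_SucI)
      fix t
      have "F t x \<le> (\<integral>y. F 1 y \<partial>kernel_power M P t x)"
        unfolding F_def[of t]
      proof (rule integral_mono[OF int[OF h2 h2b] int[OF F Fb]])
        fix y assume "y \<in> space (kernel_power M P t x)"
        then have y: "y \<in> space M" by (simp add: K)
        note Py = kernel_space[OF P y]
        show "(h y)\<^sup>2 \<le> F 1 y"
          using power2_integral_le_prob[OF Py(1) integrable_bounded_prob[OF Py(1,2) h hb]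
              integrable_bounded_prob[OF Py(1,2) h2 h2b]] harm[OF y] kernel_power_1[OF P y]
          by (simp add: F_def)
      qed
      then show "F t x \<le> F (Suc t) x" using F_add[where n=1] by simp
    qed
    then have "(\<lambda>t. (\<integral>n. F (t + n) x \<partial>?w) - F t x) \<longlonglongrightarrow> 0"
      by (rule integral_pmf_shift_tendsto_0) (rule Fb[OF x])
    then have "(\<lambda>t. c * ((\<integral>n. F (t + n) x \<partial>?w) - F t x)) \<longlonglongrightarrow> c * 0"
      by (intro tendsto_intros)
    \<comment> \<open>The left side of \<open>bound\<close> does not depend on \<open>t\<close>, so
      it lies below the limit of the right side.\<close>
    then have "(f x)\<^sup>2 \<le> c * 0"
      using bound by (intro LIMSEQ_le_const) auto
    then show ?thesis by simp
  qed
  then show "h \<in> bounded_harmonic M Q"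
    using h bdd by (simp add: bounded_harmonic_def f_def g_def)
qed

end
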